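(* Let $p$ be an odd prime, $d$ a positive odd integer, $h\in\mathbb{Z}$, and $n\in\mathbb{Z}$ with $n\geq 0$. Let $q\in\mathbb{C}_p$ with $|1-q|_p<p^{-1/(p-1)}$, and let $\xi$ be an $r$-th root of unity with $(r,pd)=1$ and $|1-\xi|_p\geq 1$. For $N\in\mathbb{N}$ and $0\le a<dp^N$ define $$\mu_{n,\xi,q}^{(h)}\left(a+dp^N\mathbb{Z}_p\right)=[dp^N]_q^n\,\frac{[2]_q}{[2]_{q^{dp^N}}}\,(-1)^a\xi^a q^{ha}\,E^{(h)}_{n,q^{dp^N},\xi^{dp^N}}\!\left(\frac{a}{dp^N}\right).$$ Then $\mu_{n,\xi,q}^{(h)}$ extends uniquely to a measure on $\mathbb{X}$, i.e. to a finitely additive $\mathbb{C}_p$-valued distribution on the compact-open subsets of $\mathbb{X}$ whose values are bounded in $|\cdot|_p$.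
   Context: $\mathbb{C}_p$ is the completion of an algebraic closure of $\mathbb{Q}_p$, $|\cdot|_p$ the normalized $p$-adic absolute value. $\mathbb{X}=\varprojlim_N \mathbb{Z}/dp^N\mathbb{Z}$, and for $0\le a<dp^N$, $a+dp^N\mathbb{Z}_p=\{x\in\mathbb{X}: x\equiv a \pmod{dp^N}\}$; these sets form a basis of compact-open subsets of $\mathbb{X}$. For $x\in\mathbb{Z}_p$, $q^x=\exp(x\log q)$. Notation: $[x]_q=\frac{1-q^x}{1-q}$, so $[2]_q=1+q$. For $w\in\mathbb{C}_p$ and a positive integer $n$ (and $n=0$), the twisted $(h,q)$-Euler polynomials are given by $$E^{(h)}_{n,q,w}(x)=\frac{[2]_q}{(1-q)^n}\sum_{j=0}^n\binom{n}{j}(-1)^j q^{xj}\frac{1}{1+wq^{h+j}}.$$ In the expression $E^{(h)}_{n,q^{m},\xi^{m}}(a/m)$ with $m=dp^N$, the power $(q^{m})^{(a/m)j}$ is understood as $q^{aj}$.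
   Formalization: The case ξ = -1 is excluded by an added assumption: it satisfies all stated hypotheses (r = 2), but there the denominators 1 - q^{dp^N(h+j)} vanish or tend to 0, so the distribution is undefined or unbounded. *)

theory Defs
  imports "HOL-Analysis.Analysis" "HOL-Computational_Algebra.Polynomial"
begin

section \<open>The field of p-adic complex numbers\<close>

locale nonarchimedean_field =
  fixes absv :: "'k::field \<Rightarrow> real"
  assumes absv_nonneg: "0 \<le> absv x"
    and absv_eq_0_iff: "absv x = 0 \<longleftrightarrow> x = 0"
    and absv_mult: "absv (x * y) = absv x * absv y"
    and absv_ultrametric: "absv (x + y) \<le> max (absv x) (absv y)"
begin

lemma absv_minus_one: "absv (- 1) = 1"
proof -
  have "absv 1 * absv 1 = absv 1" "absv 1 \<noteq> 0"
    using absv_mult[of 1 1] absv_eq_0_iff[of 1] by simp_all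
  then have "absv 1 = 1" by simp
  then have "(absv (- 1))\<^sup>2 = 1"
    using absv_mult[of "- 1" "- 1"] by (simp add: power2_eq_square)
  then show ?thesis
    using absv_nonneg[of "- 1"] by (simp add: power2_eq_1_iff)
qed

lemma absv_minus: "absv (- x) = absv x"
  using absv_mult[of "- 1" x] by (simp add: absv_minus_one)

sublocale Metric_space UNIV "\<lambda>x y. absv (x - y)"
proof
  fix x y z :: 'k
  show "0 \<le> absv (x - y)" by (rule absv_nonneg)
  show "absv (x - y) = absv (y - x)" using absv_minus[of "x - y"] by simp
  show "absv (x - y) = 0 \<longleftrightarrow> x = y" by (simp add: absv_eq_0_iff)
  show "absv (x - z) \<le> absv (x - y) + absv (y - z)"
    using absv_ultrametric[of "x - y" "y - z"] absv_nonneg[of "x - y"] absv_nonneg[of "y - z"]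
    by simp
qed

end

text \<open>
  The locale \<open>Cp\<close> says that a valued field is (a model of) the completion of an algebraic closure
  of the field of p-adic numbers, with the absolute value normalized by |p| = 1/p. Such a field is
  unique up to isometric isomorphism. In a complete field of this kind the topological
  closure of the rational numbers is the completion of the rational numbers for the p-adic absolute
  value, that is, the field of p-adic numbers; the elements algebraic over it are then required to
  form an algebraically closed field, which is dense.
\<close>

locale complete_padic_field = nonarchimedean_field absv
  for absv :: "'k::field_char_0 \<Rightarrow> real" +
  fixes p :: nat
  assumes prime_p: "prime p"
    and absv_p: "absv (of_nat p) = 1 / real p"
    and complete: "mcomplete"
begin

definition Qp :: "'k set" where
  "Qp = mtopology closure_of \<rat>"

definition Qp_alg :: "'k set" where
  "Qp_alg = {x. \<exists>f. f \<noteq> 0 \<and> (\<forall>i. coeff f i \<in> Qp) \<and> poly f x = 0}"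

end

locale Cp = complete_padic_field absv p
  for absv :: "'k::field_char_0 \<Rightarrow> real" and p :: nat +
  assumes Qp_alg_closed:
      "(\<forall>i. coeff f i \<in> Qp_alg) \<Longrightarrow> degree f > 0 \<Longrightarrow> \<exists>x\<in>Qp_alg. poly f x = 0"
    and Qp_alg_dense: "mtopology closure_of Qp_alg = UNIV"


section \<open>The profinite space of compatible residues modulo d p^N\<close>

text \<open>Residue classes are represented by their least nonnegative representatives.\<close>

definition X_set :: "nat \<Rightarrow> nat \<Rightarrow> (nat \<Rightarrow> nat) set" where
  "X_set d p = {x. (\<forall>N. x N < d * p ^ N) \<and> (\<forall>M N. M \<le> N \<longrightarrow> x N mod (d * p ^ M) = x M)}"

definition X_top :: "nat \<Rightarrow> nat \<Rightarrow> (nat \<Rightarrow> nat) topology" where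
  "X_top d p =
     subtopology (product_topology (\<lambda>N. discrete_topology {..<d * p ^ N}) UNIV) (X_set d p)"

definition X_ball :: "nat \<Rightarrow> nat \<Rightarrow> nat \<Rightarrow> nat \<Rightarrow> (nat \<Rightarrow> nat) set" where
  "X_ball d p N a = {x \<in> X_set d p. x N = a}"

definition compact_opens :: "'a topology \<Rightarrow> 'a set set" where
  "compact_opens T = {U. openin T U \<and> compactin T U}"

text \<open>
  Membership in \<open>extensional\<close> only fixes the irrelevant values outside the compact-open sets, so
  that a measure is determined by its values on the compact-open sets.
\<close>

definition padic_measure ::
    "('k::field \<Rightarrow> real) \<Rightarrow> 'a topology \<Rightarrow> ('a set \<Rightarrow> 'k) \<Rightarrow> bool" where
  "padic_measure absv T \<mu> \<longleftrightarrow>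
     \<mu> \<in> extensional (compact_opens T) \<and>
     (\<forall>U\<in>compact_opens T. \<forall>V\<in>compact_opens T. U \<inter> V = {} \<longrightarrow> \<mu> (U \<union> V) = \<mu> U + \<mu> V) \<and>
     (\<exists>B. \<forall>U\<in>compact_opens T. absv (\<mu> U) \<le> B)"


section \<open>Twisted (h,q)-Euler polynomials\<close>

text \<open>At q = 1 the q-number is read as the value x of its removable singularity.\<close>

definition q_num :: "'k::field \<Rightarrow> nat \<Rightarrow> 'k" where
  "q_num q x = (if q = 1 then of_nat x else (1 - q ^ x) / (1 - q))"

text \<open>
  The polynomial depends on its argument x only through the power of q with exponent x; this power
  is the last parameter \<open>Q\<close>. Thus the value at x = a/m for the base q^m is obtained with
  \<open>Q = q ^ a\<close>, also when a/m is not a p-adic integer.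
\<close>

definition twisted_hq_Euler :: "int \<Rightarrow> nat \<Rightarrow> 'k::field \<Rightarrow> 'k \<Rightarrow> 'k \<Rightarrow> 'k" where
  "twisted_hq_Euler h n q w Q =
     q_num q 2 / (1 - q) ^ n *
     (\<Sum>j\<le>n. of_nat (n choose j) * (- 1) ^ j * Q ^ j * (1 / (1 + w * q powi (h + int j))))"

definition \<mu>_ball ::
    "nat \<Rightarrow> nat \<Rightarrow> int \<Rightarrow> nat \<Rightarrow> 'k::field \<Rightarrow> 'k \<Rightarrow> nat \<Rightarrow> nat \<Rightarrow> 'k" where
  "\<mu>_ball d p h n \<xi> q N a =
     (let m = d * p ^ N in
        q_num q m ^ n * (q_num q 2 / q_num (q ^ m) 2) * (- 1) ^ a * \<xi> ^ a * q powi (h * int a) *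
        twisted_hq_Euler h n (q ^ m) (\<xi> ^ m) (q ^ a))"

end

theory Submission
  imports Defs
begin

text \<open>
  With \<open>m = d p^N\<close> and \<open>z\<^sub>j = - \<xi> q^(h+j)\<close>, the prescribed value on \<open>a + m Z\<^sub>p\<close> is a fixed linear
  combination of the quotients \<open>z\<^sub>j^a / (1 - z\<^sub>j^m)\<close>, because \<open>[m]\<^sub>q^n / (1 - q^m)^n = 1 / (1 - q)^n\<close>.
  Summing a geometric progression over the \<open>p\<close> subclasses modulo \<open>p m\<close> shows that these values are
  compatible.  Boundedness comes from \<open>|1 - z\<^sub>j^m| \<ge> 1\<close>: the element \<open>(- \<xi>)^m\<close> is a root of unity
  of order prime to \<open>p\<close> and different from \<open>1\<close>, hence at distance at least \<open>1\<close> from \<open>1\<close>, whereas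
  \<open>q\<close> and its powers are at distance less than \<open>1\<close> from \<open>1\<close>.  Since every compact-open set is
  determined by finitely many residues, a compatible family extends uniquely, and the ultrametric
  inequality preserves the bound.
\<close>

section \<open>Compact-open subsets of the space of compatible residues\<close>

lemma X_set_less: "x \<in> X_set d p \<Longrightarrow> x N < d * p ^ N"
  and X_set_mod: "x \<in> X_set d p \<Longrightarrow> M \<le> N \<Longrightarrow> x N mod (d * p ^ M) = x M"
  by (auto simp: X_set_def)

text \<open>The image of a natural number in the projective limit. It serves as an explicit point
  with prescribed residues, so that balls are seen to be nonempty.\<close>

definition nat_point :: "nat \<Rightarrow> nat \<Rightarrow> nat \<Rightarrow> nat \<Rightarrow> nat" where
  "nat_point d p a = (\<lambda>N. a mod (d * p ^ N))"

lemma nat_point_in_X_set: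
  assumes "d > 0" "p > 0"
  shows "nat_point d p a \<in> X_set d p"
  using assms by (auto simp: X_set_def nat_point_def le_imp_power_dvd mod_mod_cancel)

lemma topspace_X_top: "topspace (X_top d p) = X_set d p"
  by (auto simp: X_top_def X_set_def PiE_def)

lemma continuous_map_X_top_component:
  "continuous_map (X_top d p) (discrete_topology {..<d * p ^ N}) (\<lambda>x. x N)"
  unfolding X_top_def
  by (intro continuous_map_from_subtopology continuous_map_product_projection) simp

text \<open>By Tychonoff the product of the finite residue sets is compact, and the compatible
  sequences form a closed subset, being cut out by conditions on two coordinates at a time.\<close>

lemma compact_space_X_top: "compact_space (X_top d p)"
proof -
  let ?P = "product_topology (\<lambda>N. discrete_topology {..<d * p ^ N}) (UNIV :: nat set)"
  let ?C = "\<lambda>M N. {x \<in> topspace ?P. (x N, x M) \<in> {(b, a). b mod (d * p ^ M) = a} \<inter> {..<d * p ^ N} \<times> {..<d * p ^ M}}"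
  have "closedin ?P (?C M N)" for M N
  proof (rule closedin_continuous_map_preimage)
    show "continuous_map ?P (prod_topology (discrete_topology {..<d * p ^ N}) (discrete_topology {..<d * p ^ M}))
        (\<lambda>x. (x N, x M))"
      by (intro continuous_map_pairedI continuous_map_product_projection) auto
  qed (auto simp flip: prod_topology_discrete_topology)
  then have "closedin ?P (topspace ?P \<inter> (\<Inter>M. \<Inter>N\<in>{M..}. ?C M N))"
    by (intro closedin_Int closedin_topspace closedin_Inter) auto
  also have "topspace ?P \<inter> (\<Inter>M. \<Inter>N\<in>{M..}. ?C M N) = X_set d p"
    by (auto simp: X_set_def PiE_def Pi_def)
  finally have "compactin ?P (X_set d p)"
    by (intro closedin_compact_space)
       (simp_all add: compact_space_product_topology compact_space_discrete_topology)
  then show ?thesis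
    by (simp add: X_top_def compact_space_subtopology)
qed

text \<open>Such a \<open>U\<close> is a union of balls of level \<open>N\<close>: the preimage of a
  set of residues modulo d p^N.\<close>

definition at_level :: "nat \<Rightarrow> nat \<Rightarrow> nat \<Rightarrow> (nat \<Rightarrow> nat) set \<Rightarrow> bool" where
  "at_level d p N U \<longleftrightarrow> U \<subseteq> X_set d p \<and> (\<forall>x\<in>U. \<forall>y\<in>X_set d p. y N = x N \<longrightarrow> y \<in> U)"

definition residues_at :: "nat \<Rightarrow> (nat \<Rightarrow> nat) set \<Rightarrow> nat set" where
  "residues_at N U = (\<lambda>x. x N) ` U"

lemma at_level_mono:
  assumes "at_level d p M U" "M \<le> N"
  shows "at_level d p N U"
  using assms unfolding at_level_def by (metis X_set_mod subsetD)

lemma at_level_X_ball: "at_level d p N (X_ball d p N a)"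
  by (auto simp: at_level_def X_ball_def)

lemma at_level_Un: "at_level d p N U \<Longrightarrow> at_level d p N V \<Longrightarrow> at_level d p N (U \<union> V)"
  by (auto simp: at_level_def)

lemma residues_at_less: "at_level d p N U \<Longrightarrow> residues_at N U \<subseteq> {..<d * p ^ N}"
  by (auto simp: at_level_def residues_at_def X_set_less)

lemma finite_residues_at: "at_level d p N U \<Longrightarrow> finite (residues_at N U)"
  by (meson finite_lessThan finite_subset residues_at_less)

lemma at_level_eq_Union:
  assumes "at_level d p N U"
  shows "U = (\<Union>a\<in>residues_at N U. X_ball d p N a)"
  using assms by (auto simp: at_level_def residues_at_def X_ball_def)

lemma at_level_compact_open:
  assumes "at_level d p N U"
  shows "U \<in> compact_opens (X_top d p)"
proof -
  have U: "U = {x \<in> topspace (X_top d p). x N \<in> residues_at N U}"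
    using assms unfolding at_level_def residues_at_def topspace_X_top by auto
  have "openin (X_top d p) U"
    by (subst U, rule openin_continuous_map_preimage[OF continuous_map_X_top_component])
       (use residues_at_less[OF assms] in simp)
  moreover have "closedin (X_top d p) U"
    by (subst U, rule closedin_continuous_map_preimage[OF continuous_map_X_top_component])
       (use residues_at_less[OF assms] in simp)
  ultimately show ?thesis
    by (simp add: compact_opens_def closedin_compact_space compact_space_X_top)
qed

text \<open>A basic open set of the product restricts only finitely many coordinates, and in a
  compatible sequence one coordinate determines all earlier ones. So fixing one coordinate whose
  index bounds the restricted ones suffices.\<close>

lemma openin_X_top_ball:
  assumes "openin (X_top d p) U" "x \<in> U"
  shows "\<exists>N. X_ball d p N (x N) \<subseteq> U"
proof -
  let ?T = "\<lambda>N. discrete_topology {..<d * p ^ N}"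
  obtain V where V: "openin (product_topology ?T UNIV) V" "U = V \<inter> X_set d p"
    using assms(1) by (auto simp: X_top_def openin_subtopology)
  then obtain W where W: "finite {i. W i \<noteq> {..<d * p ^ i}}" "x \<in> Pi\<^sub>E UNIV W" "Pi\<^sub>E UNIV W \<subseteq> V"
    using assms(2) unfolding openin_product_topology_alt by fastforce
  obtain N where N: "\<And>i. W i \<noteq> {..<d * p ^ i} \<Longrightarrow> i \<le> N"
    using W(1) unfolding finite_nat_set_iff_bounded_le by blast
  have xX: "x \<in> X_set d p"
    using assms(2) V by auto
  have "y \<in> U" if y: "y \<in> X_set d p" "y N = x N" for y
  proof -
    have "y i \<in> W i" for i
    proof (cases "i \<le> N")
      case True
      then have "y i = x i"
        using X_set_mod[OF y(1) True] X_set_mod[OF xX True] y(2) by simp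
      then show ?thesis using W(2) by auto
    next
      case False
      then show ?thesis using N[of i] X_set_less[OF y(1)] by auto
    qed
    then show ?thesis using W(3) V(2) y(1) by auto
  qed
  then show ?thesis by (auto simp: X_ball_def)
qed

text \<open>The points whose ball of level \<open>N\<close> lies in \<open>U\<close> form an
  increasing sequence of open sets covering \<open>U\<close>; by compactness one of them is already
  all of \<open>U\<close>.\<close>

lemma compact_open_at_level:
  assumes "U \<in> compact_opens (X_top d p)"
  obtains N where "at_level d p N U"
proof -
  define W where "W N = {x \<in> X_set d p. X_ball d p N (x N) \<subseteq> U}" for N
  have lev: "at_level d p N (W N)" for N
    by (auto simp: at_level_def W_def)
  have mono: "W M \<subseteq> W N" if "M \<le> N" for M N
    using that by (fastforce simp: W_def X_ball_def dest: X_set_mod)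
  have sub: "W N \<subseteq> U" for N
    by (auto simp: W_def X_ball_def)
  have U: "openin (X_top d p) U" "compactin (X_top d p) U"
    using assms by (auto simp: compact_opens_def)
  have "U \<subseteq> X_set d p"
    using U(1) openin_subset topspace_X_top by blast
  then have "U \<subseteq> \<Union>(range W)"
    using openin_X_top_ball[OF U(1)] by (auto simp: W_def)
  moreover have "openin (X_top d p) V" if "V \<in> range W" for V
    using that at_level_compact_open[OF lev] by (auto simp: compact_opens_def)
  ultimately obtain F where F: "finite F" "F \<subseteq> range W" "U \<subseteq> \<Union>F"
    using compactinD[OF U(2), of "range W"] by blast
  then obtain I where I: "finite I" "F = W ` I"
    by (metis finite_subset_image)
  obtain N where "\<And>i. i \<in> I \<Longrightarrow> i \<le> N"
    using I(1) unfolding finite_nat_set_iff_bounded_le by blast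
  then have "U \<subseteq> W N"
    using F(3) I(2) mono by blast
  then have "U = W N"
    using sub by blast
  then show ?thesis using lev that by blast
qed

text \<open>Each class modulo m = d p^N splits into the p classes a + i m modulo p m, with i the
  quotient by m; a set of level \<open>N\<close> contains all of them or none.\<close>

lemma residues_at_Suc:
  assumes "at_level d p N U" "d > 0" "p > 0"
  shows "residues_at (Suc N) U = (\<lambda>(a, i). a + i * (d * p ^ N)) ` (residues_at N U \<times> {..<p})"
proof (intro equalityI subsetI)
  fix b assume "b \<in> residues_at (Suc N) U"
  then obtain x where x: "x \<in> U" "b = x (Suc N)"
    by (auto simp: residues_at_def)
  then have xX: "x \<in> X_set d p"
    using assms(1) by (auto simp: at_level_def)
  define i where "i = b div (d * p ^ N)"
  have "b < p * (d * p ^ N)"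
    using X_set_less[OF xX, of "Suc N"] x(2) by (simp add: mult_ac)
  then have "i < p"
    unfolding i_def by (simp add: less_mult_imp_div_less)
  moreover have "b = x N + i * (d * p ^ N)"
    using X_set_mod[OF xX, of N "Suc N"] x(2) unfolding i_def
    by (metis le_SucI le_refl mod_div_mult_eq)
  ultimately show "b \<in> (\<lambda>(a, i). a + i * (d * p ^ N)) ` (residues_at N U \<times> {..<p})"
    using x(1) by (force simp: residues_at_def)
next
  fix b assume "b \<in> (\<lambda>(a, i). a + i * (d * p ^ N)) ` (residues_at N U \<times> {..<p})"
  then obtain x i where x: "x \<in> U" "i < p" "b = x N + i * (d * p ^ N)"
    by (auto simp: residues_at_def)
  then have xX: "x \<in> X_set d p"
    using assms(1) by (auto simp: at_level_def)
  \<comment> \<open>As x N < m, this gives b < (i + 1) m \<le> p m, so b is its own residue at level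
    N + 1.\<close>
  have "Suc i * (d * p ^ N) \<le> p * (d * p ^ N)"
    using x(2) by (intro mult_right_mono) auto
  then have "b < d * p ^ Suc N"
    using x(3) X_set_less[OF xX, of N] by (simp add: algebra_simps)
  then have "nat_point d p b (Suc N) = b"
    by (simp add: nat_point_def)
  moreover have "nat_point d p b N = x N"
    using X_set_less[OF xX, of N] x(3) by (simp add: nat_point_def)
  then have "nat_point d p b \<in> U"
    using assms x(1) nat_point_in_X_set[of d p b] by (auto simp: at_level_def)
  ultimately show "b \<in> residues_at (Suc N) U"
    unfolding residues_at_def by (metis imageI)
qed

section \<open>Extension of compatible bounded families to measures\<close>

text \<open>Division with remainder by m turns the finer sum into a double sum over (a, i), whose
  inner sum is the compatibility relation.\<close>

lemma sum_residues_at_Suc: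
  fixes f :: "nat \<Rightarrow> nat \<Rightarrow> 'a::comm_monoid_add"
  assumes "at_level d p N U" "d > 0" "p > 0"
    and compat: "\<And>a. a < d * p ^ N \<Longrightarrow> (\<Sum>i<p. f (Suc N) (a + i * (d * p ^ N))) = f N a"
  shows "(\<Sum>a\<in>residues_at (Suc N) U. f (Suc N) a) = (\<Sum>a\<in>residues_at N U. f N a)"
proof -
  let ?m = "d * p ^ N"
  have less: "a < ?m" if "a \<in> residues_at N U" for a
    using residues_at_less[OF assms(1)] that by auto
  have "inj_on (\<lambda>(a, i). a + i * ?m) (residues_at N U \<times> {..<p})"
  proof (rule inj_onI, clarify)
    fix a i b j
    assume "a \<in> residues_at N U" "b \<in> residues_at N U" and eq: "a + i * ?m = b + j * ?m"
    then have "a = b"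
      using less by (metis mod_less mod_mult_self1)
    then show "a = b \<and> i = j"
      using eq assms(2,3) by simp
  qed
  then have "(\<Sum>a\<in>residues_at (Suc N) U. f (Suc N) a)
      = (\<Sum>(a, i)\<in>residues_at N U \<times> {..<p}. f (Suc N) (a + i * ?m))"
    by (simp add: residues_at_Suc[OF assms(1-3)] sum.reindex case_prod_unfold)
  also have "\<dots> = (\<Sum>a\<in>residues_at N U. f N a)"
    by (simp add: compat less flip: sum.cartesian_product)
  finally show ?thesis .
qed

lemma sum_residues_at_mono:
  fixes f :: "nat \<Rightarrow> nat \<Rightarrow> 'a::comm_monoid_add"
  assumes "at_level d p M U" "M \<le> N" "d > 0" "p > 0"
    and compat: "\<And>N a. a < d * p ^ N \<Longrightarrow> (\<Sum>i<p. f (Suc N) (a + i * (d * p ^ N))) = f N a"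
  shows "(\<Sum>a\<in>residues_at N U. f N a) = (\<Sum>a\<in>residues_at M U. f M a)"
  using assms(2)
proof (induction rule: dec_induct)
  case (step N)
  then show ?case
    using sum_residues_at_Suc[where f = f, OF at_level_mono[OF assms(1)] assms(3,4) compat] by simp
qed simp

text \<open>For uniqueness: finite additivity over the disjoint balls that make up \<open>U\<close>
  forces the value.\<close>

lemma additive_eq_sum_balls:
  fixes \<mu> :: "(nat \<Rightarrow> nat) set \<Rightarrow> 'k::field"
  assumes "padic_measure absv (X_top d p) \<mu>" "at_level d p N U"
  shows "\<mu> U = (\<Sum>a\<in>residues_at N U. \<mu> (X_ball d p N a))"
proof -
  have add: "\<mu> (U \<union> V) = \<mu> U + \<mu> V"
    if "U \<in> compact_opens (X_top d p)" "V \<in> compact_opens (X_top d p)" "U \<inter> V = {}" for U V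
    using assms(1) that by (auto simp: padic_measure_def)
  have lev: "at_level d p N (\<Union>a\<in>A. X_ball d p N a)" for A
    by (auto simp: at_level_def X_ball_def)
  have "finite A \<Longrightarrow> \<mu> (\<Union>a\<in>A. X_ball d p N a) = (\<Sum>a\<in>A. \<mu> (X_ball d p N a))" for A
  proof (induction rule: finite_induct)
    case empty
    \<comment> \<open>Additivity for the pair of two empty sets forces the value 0.\<close>
    have "{} \<in> compact_opens (X_top d p)"
      using at_level_compact_open[of d p 0 "{}"] by (simp add: at_level_def)
    from add[OF this this] have "\<mu> {} = 0"
      by (simp only: Int_empty_left Un_empty_left simp_thms add_cancel_right_right)
    then show ?case by simp
  next
    case (insert a A)
    have "\<mu> (X_ball d p N a \<union> (\<Union>a\<in>A. X_ball d p N a))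
        = \<mu> (X_ball d p N a) + \<mu> (\<Union>a\<in>A. X_ball d p N a)"
      using insert(2)
      by (intro add at_level_compact_open[OF lev] at_level_compact_open[OF at_level_X_ball])
         (auto simp: X_ball_def)
    then show ?case using insert by simp
  qed
  then show ?thesis
    using at_level_eq_Union[OF assms(2)] finite_residues_at[OF assms(2)] by metis
qed

section \<open>Ultrametric estimates and the extension theorem\<close>

context nonarchimedean_field
begin

lemma absv_zero [simp]: "absv 0 = 0"
  by (simp add: absv_eq_0_iff)

lemma absv_one [simp]: "absv 1 = 1"
  using absv_minus_one absv_minus[of 1] by simp

lemma absv_power: "absv (x ^ k) = absv x ^ k"
  by (induction k) (simp_all add: absv_mult)

lemma absv_inverse: "absv (inverse x) = inverse (absv x)"
proof (cases "x = 0")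
  case False
  then have "absv x * absv (inverse x) = 1"
    by (simp flip: absv_mult)
  then show ?thesis by (metis inverse_unique)
qed simp

lemma absv_divide: "absv (x / y) = absv x / absv y"
  by (simp add: divide_inverse absv_mult absv_inverse)

lemma absv_sum_le:
  assumes "\<And>i. i \<in> I \<Longrightarrow> absv (f i) \<le> B" "B \<ge> 0"
  shows "absv (sum f I) \<le> B"
  using assms
proof (induction I rule: infinite_finite_induct)
  case (insert i I)
  then show ?case
    using absv_ultrametric[of "f i" "sum f I"] by fastforce
qed simp_all

lemma absv_add_less: "absv x < B \<Longrightarrow> absv y < B \<Longrightarrow> absv (x + y) < B"
  using absv_ultrametric[of x y] by simp

lemma absv_sum_less:
  assumes "\<And>i. i \<in> I \<Longrightarrow> absv (f i) < B" "B > 0"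
  shows "absv (sum f I) < B"
  using assms
  by (induction I rule: infinite_finite_induct) (auto intro: absv_add_less)

lemma absv_of_nat_le: "absv (of_nat k) \<le> 1"
proof (induction k)
  case (Suc k)
  then show ?case
    using absv_ultrametric[of 1 "of_nat k"] by simp
qed simp

text \<open>The measure of \<open>U\<close> is the sum of \<open>f\<close> over the residues of
  \<open>U\<close> at any level where \<open>U\<close> is a union of balls. A common level for two
  sets gives additivity, and the ultrametric inequality keeps the bound \<open>B\<close> regardless
  of the number of balls.\<close>

theorem ex1_padic_measure:
  fixes f :: "nat \<Rightarrow> nat \<Rightarrow> 'k"
  assumes "d > 0" "p > 0"
    and compat: "\<And>N a. a < d * p ^ N \<Longrightarrow> (\<Sum>i<p. f (Suc N) (a + i * (d * p ^ N))) = f N a"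
    and bounded: "\<And>N a. a < d * p ^ N \<Longrightarrow> absv (f N a) \<le> B"
  shows "\<exists>!\<mu>. padic_measure absv (X_top d p) \<mu> \<and>
    (\<forall>N a. a < d * p ^ N \<longrightarrow> \<mu> (X_ball d p N a) = f N a)"
proof
  \<comment> \<open>The least level is only a definite choice; by compatibility every admissible
    level gives the same sum.\<close>
  define \<mu> where "\<mu> = (\<lambda>U\<in>compact_opens (X_top d p).
    let N = LEAST N. at_level d p N U in \<Sum>a\<in>residues_at N U. f N a)"
  have \<mu>: "\<mu> U = (\<Sum>a\<in>residues_at N U. f N a)" if "at_level d p N U" for N U
    using sum_residues_at_mono[where f = f, OF LeastI[of "\<lambda>N. at_level d p N U", OF that]
        Least_le[of "\<lambda>N. at_level d p N U", OF that] assms(1,2) compat]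
      at_level_compact_open[OF that]
    by (simp add: \<mu>_def Let_def)
  have "\<mu> (U \<union> V) = \<mu> U + \<mu> V"
    if UV: "U \<in> compact_opens (X_top d p)" "V \<in> compact_opens (X_top d p)" "U \<inter> V = {}" for U V
  proof -
    obtain M where M: "at_level d p M U"
      by (rule compact_open_at_level[OF UV(1)])
    obtain N where N: "at_level d p N V"
      by (rule compact_open_at_level[OF UV(2)])
    let ?K = "max M N"
    have K: "at_level d p ?K U" "at_level d p ?K V"
      using at_level_mono[OF M] at_level_mono[OF N] by auto
    moreover have "residues_at ?K U \<inter> residues_at ?K V = {}"
      using K UV(3) unfolding at_level_def residues_at_def by fastforce
    moreover have "residues_at ?K (U \<union> V) = residues_at ?K U \<union> residues_at ?K V"
      by (auto simp: residues_at_def)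
    ultimately show ?thesis
      by (simp add: \<mu>[OF K(1)] \<mu>[OF K(2)] \<mu>[OF at_level_Un[OF K]] sum.union_disjoint finite_residues_at)
  qed
  moreover have "absv (\<mu> U) \<le> B" if U: "U \<in> compact_opens (X_top d p)" for U
  proof -
    obtain N where N: "at_level d p N U"
      by (rule compact_open_at_level[OF U])
    \<comment> \<open>This covers the empty sum; the class 0 at level 0 exists because d >
      0.\<close>
    have "0 \<le> B"
      using bounded[of 0 0] assms(1) absv_nonneg[of "f 0 0"] by simp
    then show ?thesis
      using residues_at_less[OF N] bounded by (auto simp: \<mu>[OF N] intro!: absv_sum_le)
  qed
  moreover have "\<mu> \<in> extensional (compact_opens (X_top d p))"
    by (simp add: \<mu>_def)
  ultimately have "padic_measure absv (X_top d p) \<mu>"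
    by (auto simp: padic_measure_def)
  moreover have "\<mu> (X_ball d p N a) = f N a" if "a < d * p ^ N" for N a
  proof -
    have "nat_point d p a \<in> X_ball d p N a"
      using nat_point_in_X_set[OF assms(1,2), of a] that by (simp add: X_ball_def nat_point_def)
    then have "residues_at N (X_ball d p N a) = {a}"
      by (force simp: residues_at_def X_ball_def)
    then show ?thesis
      by (simp add: \<mu>[OF at_level_X_ball])
  qed
  ultimately show "padic_measure absv (X_top d p) \<mu> \<and>
      (\<forall>N a. a < d * p ^ N \<longrightarrow> \<mu> (X_ball d p N a) = f N a)"
    by blast
  fix \<nu>
  assume \<nu>: "padic_measure absv (X_top d p) \<nu> \<and>
      (\<forall>N a. a < d * p ^ N \<longrightarrow> \<nu> (X_ball d p N a) = f N a)"
  show "\<nu> = \<mu>"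
  proof (rule extensionalityI)
    show "\<nu> \<in> extensional (compact_opens (X_top d p))"
      using \<nu> by (simp add: padic_measure_def)
    show "\<mu> \<in> extensional (compact_opens (X_top d p))"
      by (simp add: \<mu>_def)
    fix U assume "U \<in> compact_opens (X_top d p)"
    then obtain N where N: "at_level d p N U"
      by (rule compact_open_at_level)
    have "\<nu> U = (\<Sum>a\<in>residues_at N U. \<nu> (X_ball d p N a))"
      using additive_eq_sum_balls \<nu> N by blast
    also have "\<dots> = \<mu> U"
      using residues_at_less[OF N] \<nu> by (auto simp: \<mu>[OF N] intro!: sum.cong)
    finally show "\<nu> U = \<mu> U" .
  qed
qed

section \<open>Roots of unity close to 1\<close>

lemma absv_eq_one:
  assumes "absv (1 - x) < 1"
  shows "absv x = 1"
proof -
  have "absv x \<le> 1"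
    using absv_ultrametric[of 1 "- (1 - x)"] assms by (simp only: absv_minus) simp
  moreover have "1 \<le> max (absv (1 - x)) (absv x)"
    using absv_ultrametric[of "1 - x" x] by simp
  ultimately show ?thesis using assms by simp
qed

text \<open>Write 1 - x y = (1 - x) + x (1 - y) and use |x| = 1.\<close>

lemma one_minus_mult_less:
  assumes "absv (1 - x) < B" "absv (1 - y) < B" "B \<le> 1"
  shows "absv (1 - x * y) < B"
proof -
  have "absv x = 1"
    using absv_eq_one assms by simp
  then have "absv (x * (1 - y)) < B"
    using assms by (simp add: absv_mult)
  then have "absv ((1 - x) + x * (1 - y)) < B"
    using assms(1) by (intro absv_add_less)
  then show ?thesis by (simp add: algebra_simps)
qed

lemma one_minus_power_less:
  assumes "absv (1 - x) < B" "B \<le> 1"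
  shows "absv (1 - x ^ k) < B"
proof (induction k)
  case 0
  then show ?case using order.strict_trans1[OF absv_nonneg assms(1)] by simp
next
  case (Suc k)
  then show ?case using one_minus_mult_less assms by simp
qed

text \<open>Negative exponents, which occur for h + j, reduce to positive ones by 1 - 1/x = -(1 -
  x)/x and |x| = 1.\<close>

lemma one_minus_powi_less_one:
  assumes "absv (1 - x) < 1"
  shows "absv (1 - x powi k) < 1"
proof -
  have "absv x = 1" "x \<noteq> 0"
    using absv_eq_one[OF assms] by auto
  moreover have "1 - inverse x = - ((1 - x) * inverse x)"
    using \<open>x \<noteq> 0\<close> by (simp add: algebra_simps)
  ultimately have "absv (1 - inverse x) < 1"
    using assms by (simp only: absv_minus absv_mult absv_inverse) simp
  then show ?thesis
    using assms by (auto simp: power_int_def intro: one_minus_power_less)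
qed

end

section \<open>Roots of unity in residue characteristic p\<close>

context complete_padic_field
begin

lemma p_gt_1: "p > 1"
  using prime_p prime_gt_1_nat by blast

text \<open>Bezout gives k u = p v + 1, which has absolute value 1; as |k| and |u| are at most 1,
  both equal 1.\<close>

lemma absv_of_nat_coprime:
  assumes "coprime k p"
  shows "absv (of_nat k) = 1"
proof -
  obtain u v where uv: "k * u = p * v + 1"
    using coprime_bezout_strong[OF assms] p_gt_1 by auto
  have "(of_nat k * of_nat u :: 'k) = of_nat p * of_nat v + 1"
    using arg_cong[OF uv, of "of_nat :: nat \<Rightarrow> 'k"] by simp
  moreover have "absv (1 - (of_nat p * of_nat v + 1)) < 1"
  proof -
    have "absv (of_nat v) / real p \<le> 1 / real p"
      by (intro divide_right_mono absv_of_nat_le) simp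
    also have "\<dots> < 1"
      using p_gt_1 by simp
    finally show ?thesis
      by (simp add: absv_minus absv_mult absv_p)
  qed
  ultimately have "absv (of_nat k) * absv (of_nat u) = 1"
    using absv_eq_one by (metis absv_mult)
  moreover have "absv (of_nat k) * absv (of_nat u) \<le> absv (of_nat k) * 1"
    by (intro mult_left_mono absv_of_nat_le absv_nonneg)
  ultimately show ?thesis
    using absv_of_nat_le[of k] by simp
qed

text \<open>If x differs from 1, then 1 + x + ... + x^(k-1) vanishes; yet its terms are close to 1,
  so it is at distance less than 1 from k, and |k| = 1.\<close>

lemma root_of_unity_coprime_eq_1:
  assumes "x ^ k = 1" "coprime k p" "absv (1 - x) < 1"
  shows "x = 1"
proof (rule ccontr)
  assume "x \<noteq> 1"
  then have 0: "(\<Sum>i<k. x ^ i) = 0"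
    using assms(1) geometric_sum[of x k] by simp
  have "absv (\<Sum>i<k. 1 - x ^ i) < 1"
    using assms(3) by (intro absv_sum_less one_minus_power_less) auto
  then have "absv (of_nat k) < 1"
    by (simp add: sum_subtractf 0)
  then show False
    using absv_of_nat_coprime[OF assms(2)] by simp
qed

text \<open>Expand x^p = 1 with x = 1 + t. Inside this radius the linear term p t strictly dominates
  the terms of higher order, so they cannot cancel it unless t = 0.\<close>

lemma p_root_of_unity_eq_1:
  assumes "x ^ p = 1" "absv (1 - x) < real p powr (- 1 / (real p - 1))"
  shows "x = 1"
proof (rule ccontr)
  assume "x \<noteq> 1"
  define t where "t = x - 1"
  have t: "t \<noteq> 0" "x = t + 1" "absv t = absv (1 - x)"
    using \<open>x \<noteq> 1\<close> absv_minus[of "1 - x"] by (simp_all add: t_def)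
  have pos: "absv t > 0"
    using t(1) absv_nonneg[of t] absv_eq_0_iff[of t] by linarith
  \<comment> \<open>The radius is the one whose power p - 1 equals 1/p, the absolute value of
    p.\<close>
  have "absv t ^ (p - 1) < (real p powr (- 1 / (real p - 1))) ^ (p - 1)"
    using assms(2) t(3) p_gt_1 by (intro power_strict_mono absv_nonneg) auto
  also have "\<dots> = real p powr (real (p - 1) * (- 1 / (real p - 1)))"
    using p_gt_1 by (intro powr_power) simp
  also have "real (p - 1) * (- 1 / (real p - 1)) = - 1"
    using p_gt_1 by (simp add: of_nat_diff)
  also have "real p powr - 1 = absv (of_nat p)"
    using p_gt_1 by (simp add: absv_p powr_minus_divide)
  finally have pow: "absv t ^ (p - 1) < absv (of_nat p)" .
  have "real p powr (- 1 / (real p - 1)) < 1"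
    using p_gt_1 by (intro powr_less_one) auto
  then have "absv t < 1"
    using assms(2) t(3) by simp
  have "absv (of_nat (p choose k) * t ^ k) < absv (of_nat p) * absv t" if k: "k \<in> {2..p}" for k
  \<comment> \<open>The top term t^p is controlled by the radius; the middle binomial coefficients
    are divisible by p, and there |t| < 1 suffices.\<close>
  proof (cases "k = p")
    case True
    have "absv t ^ p = absv t ^ (p - 1) * absv t"
      using p_gt_1 by (simp flip: power_Suc2)
    then show ?thesis
      using True pow pos by (simp add: absv_mult absv_power)
  next
    case False
    then have "p dvd (p choose k)"
      using k prime_p by (intro dvd_choose_prime) auto
    then obtain c where "p choose k = p * c" ..
    then have "absv (of_nat (p choose k) * t ^ k) = absv (of_nat p) * (absv (of_nat c) * absv t ^ k)"
      by (simp add: absv_mult absv_power)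
    also have "\<dots> \<le> absv (of_nat p) * (1 * absv t ^ 2)"
      using k \<open>absv t < 1\<close>
      by (intro mult_left_mono mult_mono absv_of_nat_le power_decreasing absv_nonneg zero_le_power) auto
    also have "\<dots> < absv (of_nat p) * absv t"
      using \<open>absv t < 1\<close> pos p_gt_1
      by (intro mult_strict_left_mono) (simp_all add: power2_eq_square absv_p)
    finally show ?thesis .
  qed
  then have "absv (\<Sum>k\<in>{2..p}. of_nat (p choose k) * t ^ k) < absv (of_nat p) * absv t"
    using pos p_gt_1 by (intro absv_sum_less) (auto simp: absv_p)
  moreover have "(\<Sum>k\<in>{2..p}. of_nat (p choose k) * t ^ k) = - (of_nat p * t)"
  proof -
    have "{..p} = insert 0 (insert 1 {2..p})"
      using p_gt_1 by auto
    then have "1 = 1 + (of_nat p * t + (\<Sum>k\<in>{2..p}. of_nat (p choose k) * t ^ k))"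
      using assms(1) unfolding t(2) binomial_ring by (simp add: add.assoc)
    then show ?thesis
      by (simp add: add_eq_0_iff2)
  qed
  ultimately show False
    by (simp add: absv_minus absv_mult)
qed

text \<open>Passing from x to x^p stays in the disc and strips a factor p from k, until k is prime
  to p. Applied to q, it shows that q^m = 1 only for q = 1.\<close>

lemma root_of_unity_eq_1:
  assumes "x ^ k = 1" "k > 0" "absv (1 - x) < real p powr (- 1 / (real p - 1))"
  shows "x = 1"
  using assms
proof (induction k arbitrary: x rule: less_induct)
  case (less k)
  have "real p powr (- 1 / (real p - 1)) < 1"
    using p_gt_1 by (intro powr_less_one) auto
  then have lt1: "real p powr (- 1 / (real p - 1)) \<le> 1" "absv (1 - x) < 1"
    using less.prems(3) by simp_all
  show ?case
  proof (cases "p dvd k")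
    case True
    then obtain l where l: "k = p * l" ..
    then have "x ^ p = 1"
      using less.IH[of l "x ^ p"] less.prems p_gt_1 one_minus_power_less[OF less.prems(3) lt1(1), of p]
      by (simp add: power_mult)
    then show ?thesis
      using p_root_of_unity_eq_1 less.prems(3) by blast
  next
    case False
    then have "coprime k p"
      using prime_imp_coprime[OF prime_p] coprime_commute by blast
    then show ?thesis
      using root_of_unity_coprime_eq_1 less.prems(1) lt1(2) by blast
  qed
qed

text \<open>If y z were close to 1, so would be y, since 1 - y = (1 - y z) - y (1 - z) and |y| = 1;
  but a root of unity of order prime to p that is close to 1 equals 1.\<close>

lemma one_minus_root_of_unity_mult_ge_1:
  assumes "y ^ k = 1" "coprime k p" "y \<noteq> 1" "absv (1 - z) < 1"
  shows "absv (1 - y * z) \<ge> 1"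
proof (rule ccontr)
  assume "\<not> absv (1 - y * z) \<ge> 1"
  then have less: "absv (1 - y * z) < 1" by simp
  then have "absv y = 1"
    using absv_eq_one[OF less] absv_eq_one[OF assms(4)] by (simp add: absv_mult)
  then have "absv (- (y * (1 - z))) < 1"
    using assms(4) by (simp only: absv_minus absv_mult)
  then have "absv (1 - y * z + - (y * (1 - z))) < 1"
    using less absv_add_less by blast
  then have "absv (1 - y) < 1"
    by (simp add: algebra_simps)
  then show False
    using root_of_unity_coprime_eq_1 assms by blast
qed

end

lemma coprime_powers_eq_1:
  fixes x :: "'a::monoid_mult"
  assumes "x ^ k = 1" "x ^ l = 1" "coprime l k"
  shows "x = 1"
proof (cases "k = 1")
  case False
  then obtain u v where "l * u = k * v + 1"
    using coprime_bezout_strong[OF assms(3)] by blast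
  then have "(x ^ l) ^ u = (x ^ k) ^ v * x"
    by (simp flip: power_mult power_Suc2)
  then show ?thesis
    using assms(1,2) by simp
qed (use assms(1) in simp)

section \<open>The twisted Euler measure\<close>

text \<open>
  For odd \<open>m\<close> the sign in \<open>1 + \<xi>^m q^(m(h+j))\<close> is absorbed into the base \<open>z = - \<xi> q^(h+j)\<close>,
  which turns the distribution relation into a geometric sum.  The formula also holds for
  \<open>q = 1\<close>: if \<open>n > 0\<close>, both sides vanish because of the division by \<open>(1 - q)^n = 0\<close>.
\<close>

lemma \<mu>_ball_eq:
  fixes q \<xi> :: "'k::field"
  assumes "odd (d * p ^ N)" "q \<noteq> 0" "q ^ (d * p ^ N) = 1 \<Longrightarrow> q = 1"
    and "q_num (q ^ (d * p ^ N)) 2 \<noteq> 0"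
  shows "\<mu>_ball d p h n \<xi> q N a = q_num q 2 / (1 - q) ^ n *
    (\<Sum>j\<le>n. of_nat (n choose j) * (- 1) ^ j *
      ((- \<xi> * q powi (h + int j)) ^ a / (1 - (- \<xi> * q powi (h + int j)) ^ (d * p ^ N))))"
proof -
  define m where "m = d * p ^ N"
  define S where "S = (\<Sum>j\<le>n. of_nat (n choose j) * (- 1) ^ j * (q ^ a) ^ j *
    (1 / (1 + \<xi> ^ m * (q ^ m) powi (h + int j))))"
  have prefactor: "q_num q m ^ n / (1 - q ^ m) ^ n = 1 / (1 - q) ^ n"
  proof (cases "q = 1")
    case True
    then show ?thesis by (cases n) simp_all
  next
    case False
    then have "q ^ m \<noteq> 1"
      using assms(3) m_def by blast
    then show ?thesis
      using False by (simp add: q_num_def power_divide)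
  qed
  \<comment> \<open>The factor \<open>q_num (q ^ m) 2\<close> of the Euler polynomial cancels the
    denominator of the prescribed value, and the sign (-1)^a moves into (-\<xi>)^a.\<close>
  have "\<mu>_ball d p h n \<xi> q N a = (q_num q m ^ n / (1 - q ^ m) ^ n) *
      (q_num q 2 * (q_num (q ^ m) 2 / q_num (q ^ m) 2)) * ((- \<xi>) ^ a * q powi (h * int a) * S)"
    unfolding \<mu>_ball_def twisted_hq_Euler_def Let_def m_def[symmetric] S_def[symmetric] power_minus[of \<xi>]
    by simp
  also have "\<dots> = q_num q 2 / (1 - q) ^ n * ((- \<xi>) ^ a * q powi (h * int a) * S)"
    using assms(4) by (simp add: prefactor m_def[symmetric])
  also have "(- \<xi>) ^ a * q powi (h * int a) * S = (\<Sum>j\<le>n. of_nat (n choose j) * (- 1) ^ j *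
      ((- \<xi> * q powi (h + int j)) ^ a / (1 - (- \<xi> * q powi (h + int j)) ^ m)))"
    unfolding S_def sum_distrib_left
  proof (rule sum.cong[OF refl])
    fix j
    have "(- \<xi> * q powi (h + int j)) ^ a = (- \<xi>) ^ a * q powi ((h + int j) * int a)"
      by (simp only: power_mult_distrib power_int_power')
    also have "(h + int j) * int a = h * int a + int (a * j)"
      by (simp add: algebra_simps)
    also have "q powi (h * int a + int (a * j)) = q powi (h * int a) * (q ^ a) ^ j"
      using assms(2) by (simp add: power_int_add power_mult del: of_nat_mult)
    finally have 1: "(- \<xi> * q powi (h + int j)) ^ a = (- \<xi>) ^ a * (q powi (h * int a) * (q ^ a) ^ j)" .
    have "(- \<xi> * q powi (h + int j)) ^ m = - (\<xi> ^ m * (q ^ m) powi (h + int j))"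
      using assms(1) unfolding m_def[symmetric]
      by (simp add: power_mult_distrib power_int_power power_int_power' mult.commute)
    then show "(- \<xi>) ^ a * q powi (h * int a) * (of_nat (n choose j) * (- 1) ^ j * (q ^ a) ^ j *
        (1 / (1 + \<xi> ^ m * (q ^ m) powi (h + int j)))) = of_nat (n choose j) * (- 1) ^ j *
        ((- \<xi> * q powi (h + int j)) ^ a / (1 - (- \<xi> * q powi (h + int j)) ^ m))"
      unfolding 1 by simp
  qed
  finally show ?thesis
    by (simp only: m_def)
qed

text \<open>One summand of the distribution relation: over the p subclasses the powers of z form a
  geometric progression of ratio z^m, and the numerator of its sum cancels 1 - z^(m p).\<close>

lemma sum_geometric_quotient:
  fixes z :: "'k::field"
  assumes "z ^ (m * p) \<noteq> 1"
  shows "(\<Sum>i<p. z ^ (a + i * m) / (1 - z ^ (m * p))) = z ^ a / (1 - z ^ m)"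
proof -
  have "z ^ m \<noteq> 1"
    using assms by (metis power_mult power_one)
  have "(\<Sum>i<p. z ^ (a + i * m) / (1 - z ^ (m * p)))
      = z ^ a * (\<Sum>i<p. (z ^ m) ^ i) / (1 - z ^ (m * p))"
    by (simp add: power_add mult.commute[of _ m] power_mult sum_distrib_left sum_divide_distrib)
  also have "(\<Sum>i<p. (z ^ m) ^ i) = (1 - z ^ (m * p)) / (1 - z ^ m)"
    using \<open>z ^ m \<noteq> 1\<close> by (simp add: sum_gp_strict power_mult)
  finally show ?thesis
    using assms by simp
qed

text \<open>The hypothesis \<open>\<xi> \<noteq> - 1\<close> keeps the denominators away from 0: for
  odd p the value \<xi> = -1 has |1 - \<xi>| = |2| = 1, but then the denominators are 1 - q^(m (h +
  j)), which come arbitrarily close to 0 as \<open>N\<close> grows and vanish at h + j = 0.\<close>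

theorem theorem1:
  fixes absv :: "'k::field_char_0 \<Rightarrow> real"
    and p d r n :: nat and h :: int and q \<xi> :: 'k
  assumes "Cp absv p"
    and "prime p" and "odd p"
    and "d > 0" and "odd d"
    and "absv (1 - q) < real p powr (- 1 / (real p - 1))"
    and "r > 0" and "\<xi> ^ r = 1" and "coprime r (p * d)"
    and "absv (1 - \<xi>) \<ge> 1"
    and "\<xi> \<noteq> - 1"
  shows "\<exists>!\<mu>. padic_measure absv (X_top d p) \<mu> \<and>
           (\<forall>N a. a < d * p ^ N \<longrightarrow> \<mu> (X_ball d p N a) = \<mu>_ball d p h n \<xi> q N a)"
proof -
  interpret Cp absv p by fact
  define z where "z j = - \<xi> * q powi (h + int j)" for j
  define C where "C = q_num q 2 / (1 - q) ^ n"
  have "real p powr (- 1 / (real p - 1)) < 1"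
    using p_gt_1 by (intro powr_less_one) auto
  then have q1: "absv (1 - q) < 1"
    using assms(6) by simp
  have q0: "q \<noteq> 0"
    using q1 by auto
  have odd: "odd (d * p ^ N)" for N
    using assms(3,5) by simp
  \<comment> \<open>For q^m different from 1 this number is 1 + q^m, nonzero because |1 - q^m| < 1 =
    |2|; for q^m = 1 it is 2.\<close>
  have q_num_2: "q_num (q ^ m) 2 \<noteq> 0" for m
  proof (cases "q ^ m = 1")
    case False
    have "1 + q ^ m \<noteq> 0"
    proof
      assume "1 + q ^ m = 0"
      then have "q ^ m = - 1"
        by (simp add: eq_neg_iff_add_eq_0 add.commute)
      then have "1 - q ^ m = of_nat 2"
        by simp
      moreover have "absv (of_nat 2) = 1"
        using assms(3) by (intro absv_of_nat_coprime) simp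
      ultimately show False
        using one_minus_power_less[OF q1, of m] by (simp del: of_nat_numeral)
    qed
    then show ?thesis
      using False by (simp add: q_num_def power2_eq_1_iff add_eq_0_iff)
  qed (simp add: q_num_def)
  have ball: "\<mu>_ball d p h n \<xi> q N a =
      C * (\<Sum>j\<le>n. of_nat (n choose j) * (- 1) ^ j * (z j ^ a / (1 - z j ^ (d * p ^ N))))" for N a
    unfolding z_def C_def
    using root_of_unity_eq_1[of q "d * p ^ N"] assms(4,6) p_gt_1
    by (intro \<mu>_ball_eq odd q0 q_num_2) auto
  have denom: "absv (1 - z j ^ (d * p ^ N)) \<ge> 1" for j N
  proof -
    let ?m = "d * p ^ N"
    \<comment> \<open>Otherwise the coprime exponents m and r would both send \<xi>^2 to 1, so \<xi>
      would be 1 or -1.\<close>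
    have "\<xi> ^ ?m \<noteq> - 1"
    proof
      assume "\<xi> ^ ?m = - 1"
      then have "(\<xi>\<^sup>2) ^ ?m = 1"
        by (simp add: power_mult[symmetric] mult.commute[of 2]) (simp add: power_mult)
      moreover have "(\<xi>\<^sup>2) ^ r = 1"
        using assms(8) by (simp add: power_mult[symmetric] mult.commute[of 2]) (simp add: power_mult)
      moreover have "coprime r ?m"
        using assms(9) by simp
      ultimately have "\<xi>\<^sup>2 = 1"
        using coprime_powers_eq_1 by blast
      then show False
        using assms(10,11) by (auto simp: power2_eq_1_iff)
    qed
    then have "(- \<xi>) ^ ?m \<noteq> 1"
      unfolding power_minus_odd[OF odd] by (metis minus_minus)
    \<comment> \<open>The factor 2 in the exponent removes the sign, and 2 r stays prime to p
      because p is odd.\<close>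
    moreover have "((- \<xi>) ^ ?m) ^ (2 * r) = ((\<xi> ^ r)\<^sup>2) ^ ?m"
      by (simp add: power_mult[symmetric] mult_ac)
    then have "((- \<xi>) ^ ?m) ^ (2 * r) = 1"
      using assms(8) by simp
    moreover have "coprime (2 * r) p"
      using assms(3,9) by simp
    moreover have "absv (1 - (q powi (h + int j)) ^ ?m) < 1"
      by (intro one_minus_power_less one_minus_powi_less_one q1) simp
    ultimately have "absv (1 - (- \<xi>) ^ ?m * (q powi (h + int j)) ^ ?m) \<ge> 1"
      by (intro one_minus_root_of_unity_mult_ge_1)
    then show ?thesis
      unfolding z_def power_mult_distrib .
  qed
  have absv_z: "absv (z j) = 1" for j
  proof -
    have "absv \<xi> ^ r = 1"
      using assms(8) by (simp flip: absv_power)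
    then have "absv \<xi> = 1"
      using assms(7) power_eq_iff_eq_base[of r "absv \<xi>" 1] absv_nonneg by simp
    then show ?thesis
      using absv_eq_one[OF one_minus_powi_less_one[OF q1]] by (simp add: z_def absv_mult absv_minus)
  qed
  show ?thesis
  proof (rule ex1_padic_measure)
    fix N a
    have "z j ^ (d * p ^ N * p) \<noteq> 1" for j
      using denom[of j "Suc N"] by (auto simp: mult_ac)
    then have *: "(\<Sum>i<p. z j ^ (a + i * (d * p ^ N)) / (1 - z j ^ (d * p ^ Suc N)))
        = z j ^ a / (1 - z j ^ (d * p ^ N))" for j
      using sum_geometric_quotient[of "z j" "d * p ^ N" p a] by (simp add: mult_ac)
    have "(\<Sum>i<p. \<mu>_ball d p h n \<xi> q (Suc N) (a + i * (d * p ^ N))) =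
        C * (\<Sum>j\<le>n. of_nat (n choose j) * (- 1) ^ j *
          (\<Sum>i<p. z j ^ (a + i * (d * p ^ N)) / (1 - z j ^ (d * p ^ Suc N))))"
      unfolding ball sum_distrib_left by (rule sum.swap)
    then show "(\<Sum>i<p. \<mu>_ball d p h n \<xi> q (Suc N) (a + i * (d * p ^ N))) = \<mu>_ball d p h n \<xi> q N a"
      unfolding * ball .
    \<comment> \<open>Each summand has absolute value at most 1, since |z j| = 1 and the
      denominators are at least 1; so |C| is a bound independent of \<open>N\<close> and a.\<close>
    have "absv (of_nat (n choose j) * (- 1) ^ j * (z j ^ a / (1 - z j ^ (d * p ^ N)))) \<le> 1" for j
    proof -
      have "absv (of_nat (n choose j)) * (1 / absv (1 - z j ^ (d * p ^ N))) \<le> 1 * 1"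
        using denom[of j N] by (intro mult_mono absv_of_nat_le) (auto simp: divide_le_eq_1)
      then show ?thesis
        by (simp add: absv_mult absv_divide absv_power absv_minus_one absv_z)
    qed
    then have "absv (\<Sum>j\<le>n. of_nat (n choose j) * (- 1) ^ j * (z j ^ a / (1 - z j ^ (d * p ^ N)))) \<le> 1"
      by (intro absv_sum_le) auto
    then show "absv (\<mu>_ball d p h n \<xi> q N a) \<le> absv C"
      unfolding ball absv_mult[of C] by (intro mult_left_le absv_nonneg)
  qed (use assms(4) p_gt_1 in auto)
qed

end
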